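(* (1) Let $n,r$ be positive integers. Then there exists $N$ such that for all integers $s,t$ with $s>t\ge N$ (so in particular $s>t\ge1$ and $(s,-t)\ne(2,-1)$), $$\left\lfloor \left(\sum_{k=n}^\infty \frac{1}{f_{rk}(s,-t)}\right)^{-1}\right\rfloor = f_{rn}(s,-t)-f_{r(n-1)}(s,-t)-1.$$ (2) Let $n,r$ be positive integers. Then there exists $S$ such that for all integers $s\ge S$, $$\left\lfloor \left(\sum_{k=n}^\infty \frac{1}{f_{rk}(s,-1)^2}\right)^{-1}\right\rfloor = f_{rn}(s,-1)^2-f_{r(n-1)}(s,-1)^2-1.$$
   Context: For integers $s,t$, the generalized Fibonacci sequence is $f_0(s,t)=0$, $f_1(s,t)=1$, $f_n(s,t)=s f_{n-1}(s,t)+t f_{n-2}(s,t)$ for $n\ge2$. $\lfloor x\rfloor$ denotes the floor of a real number $x$. (The paper phrases the hypotheses as "if $s,t$ are sufficiently large" and "if $s$ is sufficiently large", for fixed $n,r$.) *)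

theory Defs
  imports Complex_Main
begin

fun gfib :: "int \<Rightarrow> int \<Rightarrow> nat \<Rightarrow> int" where
  "gfib s t 0 = 0"
| "gfib s t (Suc 0) = 1"
| "gfib s t (Suc (Suc n)) = s * gfib s t (Suc n) + t * gfib s t n"

end

theory Submission
  imports Defs
begin

text \<open>
  Let \<open>q\<close> be a sequence of integers with differences \<open>h k = q (k + 1) - q k\<close>.  The defect in the
  telescoping identity for \<open>1 / h\<close> is governed by
  \<open>(h (k + 1) - h k) * q (k + 1) = h k * h (k + 1) - (q (k + 1)\<^sup>2 - q k * q (k + 2))\<close>.
  Hence \<open>1 / h k - 1 / h (k + 1) < 1 / q (k + 1)\<close> as soon as \<open>q\<close> is strictly log-concave, and
  \<open>1 / q (k + 1) \<le> 1 / (h k - 1) - 1 / (h (k + 1) - 1)\<close> as soon as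
  \<open>q (k + 1)\<^sup>2 - q k * q (k + 2) \<le> q (k + 2) - q k - 1\<close>.  Summing squeezes the inverse of the
  reciprocal sum between \<open>h 0 - 1\<close> and \<open>h 0\<close>.

  For \<open>q k = f (r * k)\<close> and its square the log-concavity defect is given by Catalan's identity
  \<open>f (m + r)\<^sup>2 - f m * f (m + 2 * r) = t ^ m * (f r)\<^sup>2\<close>, and it is dominated by \<open>q (k + 2)\<close> because
  \<open>f (m + r) \<ge> (s - 2) * f m * f r\<close>.  The threshold 4 suffices in both parts for all \<open>n\<close> and \<open>r\<close>.
\<close>

section \<open>Reciprocal sums of log-concave sequences\<close>

text \<open>The factor 3 in \<open>growth\<close> makes q grow at least like 3^k, which gives
  convergence and lets the telescoped terms tend to 0; \<open>concave\<close> and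
  \<open>defect\<close> supply the two sides of the squeeze.\<close>

lemma floor_inverse_reciprocal_sum:
  fixes q :: "nat \<Rightarrow> int"
  assumes nonneg: "0 \<le> q 0" and pos: "0 < q (Suc 0)"
    and growth: "\<And>k. 3 * q k \<le> q (Suc k)"
    and concave: "\<And>k. q k * q (Suc (Suc k)) < (q (Suc k))\<^sup>2"
    and defect: "\<And>k. (q (Suc k))\<^sup>2 - q k * q (Suc (Suc k)) \<le> q (Suc (Suc k)) - q k - 1"
  shows "summable (\<lambda>k. 1 / real_of_int (q (Suc k)))"
    and "\<lfloor>inverse (\<Sum>k. 1 / real_of_int (q (Suc k)))\<rfloor> = q (Suc 0) - q 0 - 1"
proof -
  define h where "h k = real_of_int (q (Suc k)) - real_of_int (q k)" for k
  define a where "a k = 1 / real_of_int (q (Suc k))" for k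
  have q_ge: "3 ^ k \<le> q (Suc k)" for k
  proof (induction k)
    case 0
    show ?case using pos by simp
  next
    case (Suc k)
    then show ?case using growth[of "Suc k"] by simp
  qed
  have q_ge_real: "3 ^ k \<le> real_of_int (q (Suc k))" for k
    using q_ge[of k] by (metis of_int_le_iff of_int_numeral of_int_power)
  have q_pos: "0 < real_of_int (q (Suc k))" for k
    using q_ge_real[of k] by (smt (verit) zero_less_power)
  have h_Suc: "2 * 3 ^ k \<le> h (Suc k)" for k
    using growth[of "Suc k"] q_ge_real[of k] unfolding h_def by linarith
  have h_Suc_ge2: "2 \<le> h (Suc k)" for k
    using h_Suc[of k] one_le_power[of "3::real" k] by linarith
  have "1 \<le> q (Suc 0) - q 0"
    using growth[of 0] nonneg pos by linarith
  then have h0_ge1: "1 \<le> h 0"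
    unfolding h_def by linarith
  have h_ge1: "1 \<le> h k" for k
    using h0_ge1 h_Suc_ge2[of "k - 1"] by (cases k) auto
  have identity: "(h (Suc k) - h k) * real_of_int (q (Suc k)) = h k * h (Suc k)
      - real_of_int ((q (Suc k))\<^sup>2 - q k * q (Suc (Suc k)))" for k
    unfolding h_def by (simp add: algebra_simps power2_eq_square)

  have a_le: "norm (a k) \<le> (1/3) ^ k" for k
    using q_ge_real[of k] q_pos[of k] unfolding a_def
    by (simp add: power_one_over frac_le)
  have summable_a: "summable a"
    by (rule summable_comparison_test'[of "\<lambda>k. (1/3::real) ^ k" 0]) (use a_le in auto)
  then show "summable (\<lambda>k. 1 / real_of_int (q (Suc k)))"
    unfolding a_def .
  have a_pos: "0 < a k" for k
    using q_pos[of k] unfolding a_def by simp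

  \<comment> \<open>The shift c = 0 serves the lower bound on the sum, c = 1 the upper
    bound.\<close>
  have telescope: "(\<lambda>k. 1 / (h k - c) - 1 / (h (Suc k) - c)) sums (1 / (h 0 - c))"
    if "c \<le> 1" for c
  proof -
    have "(\<lambda>k. 1 / (h (Suc k) - c)) \<longlonglongrightarrow> 0"
    proof (rule tendsto_0_le)
      show "(\<lambda>k. (1/3::real) ^ k) \<longlonglongrightarrow> 0"
        by (rule LIMSEQ_power_zero) simp
      show "\<forall>\<^sub>F k in sequentially. norm (1 / (h (Suc k) - c)) \<le> norm ((1/3::real) ^ k) * 1"
      proof (intro always_eventually allI)
        fix k
        have "3 ^ k \<le> h (Suc k) - c"
          using h_Suc[of k] one_le_power[of "3::real" k] that by linarith
        moreover have "(0::real) < 3 ^ k" by simp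
        ultimately show "norm (1 / (h (Suc k) - c)) \<le> norm ((1/3::real) ^ k) * 1"
          by (simp add: power_one_over frac_le)
      qed
    qed
    then have "(\<lambda>k. 1 / (h k - c)) \<longlonglongrightarrow> 0"
      by (rule LIMSEQ_imp_Suc)
    from telescope_sums'[OF this] show ?thesis by simp
  qed

  have lower_term: "1 / h k - 1 / h (Suc k) < a k" for k
  proof -
    have "(h (Suc k) - h k) * real_of_int (q (Suc k)) < h k * h (Suc k)"
      using identity[of k] concave[of k] by linarith
    then show ?thesis
      using h_ge1[of k] h_ge1[of "Suc k"] q_pos[of k] unfolding a_def
      by (simp add: field_simps)
  qed
  \<comment> \<open>Strictness has to survive summation, since otherwise the floor could be
    \<open>h 0\<close> itself. The termwise gaps form a convergent series of positive terms, so
    their sum is positive.\<close>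
  have "(\<lambda>k. a k - (1 / h k - 1 / h (Suc k))) sums (suminf a - 1 / h 0)"
    using telescope[of 0] summable_a by (intro sums_diff summable_sums) auto
  moreover from this have "0 < (\<Sum>k. a k - (1 / h k - 1 / h (Suc k)))"
    using lower_term by (intro suminf_pos) (simp_all add: sums_iff)
  ultimately have lower: "1 / h 0 < suminf a"
    by (simp add: sums_iff)
  have sum_pos: "0 < suminf a"
    using summable_a a_pos by (rule suminf_pos)
  have upper_bound: "inverse (suminf a) < h 0"
    using lower h0_ge1 sum_pos by (simp add: field_simps)

  \<comment> \<open>When \<open>h 0 = 1\<close>, that is q 0 = 0 and q 1 = 1, the bound 1 / (h 0 -
    1) degenerates, but then positivity of the sum is enough.\<close>
  have lower_bound: "h 0 - 1 \<le> inverse (suminf a)"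
  proof (cases "h 0 = 1")
    case True
    then show ?thesis using sum_pos by simp
  next
    case False
    have h0_gt1: "1 < h 0"
      using False h0_ge1 by simp
    have h_gt1: "1 < h k" for k
      using h0_gt1 h_Suc_ge2[of "k - 1"] by (cases k) auto
    have upper_term: "a k \<le> 1 / (h k - 1) - 1 / (h (Suc k) - 1)" for k
    proof -
      \<comment> \<open>Since q (k + 2) - q k = h k + h (k + 1), the -1 in \<open>defect\<close> is
        what completes the product (h k - 1) * (h (k + 1) - 1).\<close>
      have "real_of_int ((q (Suc k))\<^sup>2 - q k * q (Suc (Suc k))) \<le> h k + h (Suc k) - 1"
        using defect[of k] unfolding h_def by linarith
      then have "(h k - 1) * (h (Suc k) - 1) \<le> (h (Suc k) - h k) * real_of_int (q (Suc k))"
        using identity[of k] by (simp add: algebra_simps)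
      then have "a k \<le> (h (Suc k) - h k) / ((h k - 1) * (h (Suc k) - 1))"
        using h_gt1[of k] h_gt1[of "Suc k"] q_pos[of k] unfolding a_def
        by (simp add: divide_le_eq le_divide_eq)
      also have "\<dots> = 1 / (h k - 1) - 1 / (h (Suc k) - 1)"
        using h_gt1[of k] h_gt1[of "Suc k"] by (simp add: diff_frac_eq)
      finally show ?thesis .
    qed
    have "suminf a \<le> (\<Sum>k. 1 / (h k - 1) - 1 / (h (Suc k) - 1))"
      using upper_term summable_a telescope[of 1] by (intro suminf_le) (auto simp: sums_iff)
    also have "\<dots> = 1 / (h 0 - 1)"
      using telescope[of 1] by (simp add: sums_iff)
    finally show ?thesis
      using h0_gt1 sum_pos by (simp add: field_simps)
  qed
  show "\<lfloor>inverse (\<Sum>k. 1 / real_of_int (q (Suc k)))\<rfloor> = q (Suc 0) - q 0 - 1"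
    using lower_bound upper_bound unfolding a_def h_def
    by (intro floor_unique) auto
qed

section \<open>Generalized Fibonacci numbers\<close>

lemma gfib_add: "gfib s t (Suc (m + n)) = gfib s t (Suc m) * gfib s t (Suc n) + t * gfib s t m * gfib s t n"
proof (induction s t m rule: gfib.induct)
  case (3 s t m)
  have "gfib s t (Suc (Suc (Suc m) + n))
      = s * gfib s t (Suc (Suc m + n)) + t * gfib s t (Suc (m + n))"
    by simp
  also have "\<dots> = gfib s t (Suc (Suc (Suc m))) * gfib s t (Suc n)
      + t * gfib s t (Suc (Suc m)) * gfib s t n"
    unfolding 3 by (simp add: algebra_simps)
  finally show ?case .
qed simp_all

text \<open>By the recurrence, the difference is multiplied by -t when m increases by one.\<close>

lemma gfib_Cassini: "(gfib s t (Suc m))\<^sup>2 - gfib s t m * gfib s t (Suc (Suc m)) = (- t) ^ m"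
proof (induction m)
  case (Suc m)
  have "(gfib s t (Suc (Suc m)))\<^sup>2 - gfib s t (Suc m) * gfib s t (Suc (Suc (Suc m)))
      = - t * ((gfib s t (Suc m))\<^sup>2 - gfib s t m * gfib s t (Suc (Suc m)))"
    by (simp add: algebra_simps power2_eq_square)
  then show ?case using Suc by simp
qed simp

text \<open>For fixed m both sides satisfy the recurrence in j; j = 0 is trivial and j = 1 is
  Cassini.\<close>

lemma gfib_d_Ocagne:
  "gfib s t (Suc m) * gfib s t (m + j) - gfib s t m * gfib s t (Suc (m + j)) = (- t) ^ m * gfib s t j"
proof (induction s t j rule: gfib.induct)
  case (2 s t)
  then show ?case using gfib_Cassini[of s t m] by (simp add: power2_eq_square)
next
  case (3 s t j)
  have "gfib s t (Suc m) * gfib s t (m + Suc (Suc j)) - gfib s t m * gfib s t (Suc (m + Suc (Suc j)))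
     = s * (gfib s t (Suc m) * gfib s t (m + Suc j) - gfib s t m * gfib s t (Suc (m + Suc j)))
     + t * (gfib s t (Suc m) * gfib s t (m + j) - gfib s t m * gfib s t (Suc (m + j)))"
    by (simp add: algebra_simps)
  then show ?case using 3 by (simp add: algebra_simps)
qed simp

text \<open>Both sides satisfy the recurrence in i, with d'Ocagne as the case i = 1. Keeping i and j
  independent makes the induction linear; Catalan is the diagonal i = j.\<close>

lemma gfib_Vajda:
  "gfib s t (m + i) * gfib s t (m + j) - gfib s t m * gfib s t (m + i + j)
     = (- t) ^ m * gfib s t i * gfib s t j"
proof (induction s t i rule: gfib.induct)
  case (2 s t)
  then show ?case using gfib_d_Ocagne[of s t m j] by simp
next
  case (3 s t i)
  have "gfib s t (m + Suc (Suc i)) * gfib s t (m + j) - gfib s t m * gfib s t (m + Suc (Suc i) + j)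
     = s * (gfib s t (m + Suc i) * gfib s t (m + j) - gfib s t m * gfib s t (m + Suc i + j))
     + t * (gfib s t (m + i) * gfib s t (m + j) - gfib s t m * gfib s t (m + i + j))"
    by (simp add: algebra_simps)
  then show ?case using 3 by (simp add: algebra_simps)
qed simp

lemma gfib_Catalan:
  "(gfib s t (m + r))\<^sup>2 - gfib s t m * gfib s t (m + r + r) = (- t) ^ m * (gfib s t r)\<^sup>2"
  using gfib_Vajda[of s t m r r] by (simp add: power2_eq_square)

section \<open>Growth bounds for f(s,-t) with 1 <= t < s\<close>

context
  fixes s t :: int
  assumes t_ge1: "1 \<le> t" and s_gt: "t < s"
begin

text \<open>The two claims need each other: the subtracted t * f m is at most f (m + 1), and s >= t
  + 1 leaves at least t * f (m + 1), where f (m + 1) >= 0.\<close>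

lemma gfib_nonneg_mult_le: "0 \<le> gfib s (- t) m \<and> t * gfib s (- t) m \<le> gfib s (- t) (Suc m)"
proof (induction m)
  case (Suc m)
  then have "0 \<le> gfib s (- t) (Suc m)"
    using t_ge1 by (smt (verit) mult_nonneg_nonneg)
  moreover from this have "(t + 1) * gfib s (- t) (Suc m) \<le> s * gfib s (- t) (Suc m)"
    using s_gt by (intro mult_right_mono) auto
  ultimately show ?case using Suc by (simp add: algebra_simps)
qed simp

lemmas gfib_nonneg = gfib_nonneg_mult_le[THEN conjunct1]
lemmas gfib_Suc_ge_t = gfib_nonneg_mult_le[THEN conjunct2]

lemma gfib_Suc_ge: "(s - 1) * gfib s (- t) m \<le> gfib s (- t) (Suc m)"
  using gfib_Suc_ge_t[of "m - 1"] by (cases m) (simp_all add: algebra_simps)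

lemma gfib_mono_Suc: "gfib s (- t) m \<le> gfib s (- t) (Suc m)"
  using gfib_Suc_ge_t[of m] mult_right_mono[OF t_ge1 gfib_nonneg[of m]] by simp

lemma gfib_mono: "m \<le> n \<Longrightarrow> gfib s (- t) m \<le> gfib s (- t) n"
  using gfib_mono_Suc by (rule lift_Suc_mono_le)

lemma gfib_pos: "0 < m \<Longrightarrow> 0 < gfib s (- t) m"
  using gfib_mono[of 1 m] by simp

text \<open>This absorbs the power of t in Catalan's identity.\<close>

lemma gfib_add_ge_power: "t ^ j * gfib s (- t) m \<le> gfib s (- t) (m + j)"
proof (induction j)
  case (Suc j)
  have "t * (t ^ j * gfib s (- t) m) \<le> t * gfib s (- t) (m + j)"
    using Suc t_ge1 by (intro mult_left_mono) auto
  then show ?case using gfib_Suc_ge_t[of "m + j"] by (simp add: mult.assoc)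
qed simp

text \<open>For r = i + 1 the addition formula reads f (m + 1) * f r - t * f m * f i. The first
  product is at least (s - 1) * f m * f r, and t * f i <= f r costs one more f m * f r.\<close>

lemma gfib_add_ge: "(s - 2) * (gfib s (- t) m * gfib s (- t) r) \<le> gfib s (- t) (m + r)"
proof (cases r)
  case (Suc i)
  have "(s - 1) * gfib s (- t) m * gfib s (- t) r \<le> gfib s (- t) (Suc m) * gfib s (- t) r"
    using gfib_Suc_ge gfib_nonneg by (intro mult_right_mono)
  moreover have "gfib s (- t) m * (t * gfib s (- t) i) \<le> gfib s (- t) m * gfib s (- t) r"
    using gfib_Suc_ge_t[of i] gfib_nonneg Suc by (intro mult_left_mono) auto
  ultimately show ?thesis
    using gfib_add[of s "- t" m i] Suc by (simp add: algebra_simps del: gfib.simps)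
qed (simp add: gfib_nonneg)

lemma gfib_add_ge_3:
  assumes "4 \<le> s" and "0 < r"
  shows "3 * gfib s (- t) m \<le> gfib s (- t) (m + r)"
proof -
  have "3 * gfib s (- t) m \<le> (s - 1) * gfib s (- t) m"
    using assms(1) gfib_nonneg by (intro mult_right_mono) auto
  also have "\<dots> \<le> gfib s (- t) (Suc m)"
    by (rule gfib_Suc_ge)
  also have "\<dots> \<le> gfib s (- t) (m + r)"
    using assms(2) by (intro gfib_mono) simp
  finally show ?thesis .
qed

lemma gfib_less_add:
  assumes "4 \<le> s" and "0 < r"
  shows "gfib s (- t) m < gfib s (- t) (m + r)"
  using gfib_add_ge_3[OF assms, of m] gfib_nonneg[of m] gfib_pos[of "m + r"] assms(2) by linarith

lemma gfib_add_ge_twice: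
  assumes "4 \<le> s"
  shows "2 * (gfib s (- t) m * gfib s (- t) r) \<le> gfib s (- t) (m + r)"
proof -
  have "2 * (gfib s (- t) m * gfib s (- t) r) \<le> (s - 2) * (gfib s (- t) m * gfib s (- t) r)"
    using assms gfib_nonneg by (intro mult_right_mono) auto
  then show ?thesis using gfib_add_ge[of m r] by linarith
qed

section \<open>The two reciprocal sums\<close>

lemma gfib_reciprocal_sum:
  assumes s_ge4: "4 \<le> s" and r: "0 < r"
  shows "summable (\<lambda>k. 1 / real_of_int (gfib s (- t) (r * (Suc m + k))))"
    and "\<lfloor>inverse (\<Sum>k. 1 / real_of_int (gfib s (- t) (r * (Suc m + k))))\<rfloor>
      = gfib s (- t) (r * Suc m) - gfib s (- t) (r * m) - 1"
proof -
  \<comment> \<open>With m = n - 1, q starts one index before the sum, so q 0 is the term subtracted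
    in the floor formula.\<close>
  define q where "q k = gfib s (- t) (r * (m + k))" for k
  have q_Suc: "q (Suc k) = gfib s (- t) (r * (m + k) + r)"
    and q_Suc2: "q (Suc (Suc k)) = gfib s (- t) (r * (m + k) + r + r)" for k
    unfolding q_def by (simp_all add: algebra_simps)
  have Catalan: "(q (Suc k))\<^sup>2 - q k * q (Suc (Suc k)) = t ^ (r * (m + k)) * (gfib s (- t) r)\<^sup>2" for k
    using gfib_Catalan[of s "- t" "r * (m + k)" r] unfolding q_Suc2 unfolding q_Suc by (simp add: q_def)
  have "(q (Suc k))\<^sup>2 - q k * q (Suc (Suc k)) \<le> q (Suc (Suc k)) - q k - 1" for k
  proof -
    have r_pos: "1 \<le> gfib s (- t) r"
      using gfib_pos[OF r] by linarith
    \<comment> \<open>Put X = q (k + 1) * f r. The defect is at most X while q (k + 2) >= 2 * X, and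
      the spare X is at least q (k + 1) >= q k + 1.\<close>
    have "t ^ (r * (m + k)) * gfib s (- t) r * gfib s (- t) r \<le> q (Suc k) * gfib s (- t) r"
      using gfib_add_ge_power[of "r * (m + k)" r] r_pos
      by (intro mult_right_mono) (auto simp: q_Suc add.commute)
    moreover have "q (Suc k) * 1 \<le> q (Suc k) * gfib s (- t) r"
      using r_pos gfib_nonneg by (intro mult_left_mono) (auto simp: q_def)
    moreover have "q k < q (Suc k)"
      using gfib_less_add[OF s_ge4 r, of "r * (m + k)"] unfolding q_Suc by (simp add: q_def)
    moreover have "2 * (q (Suc k) * gfib s (- t) r) \<le> q (Suc (Suc k))"
      using gfib_add_ge_twice[OF s_ge4, of "r * (m + k) + r" r] unfolding q_Suc2 unfolding q_Suc .
    ultimately show ?thesis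
      unfolding Catalan unfolding power2_eq_square by (simp add: mult.assoc)
  qed
  moreover have "q k * q (Suc (Suc k)) < (q (Suc k))\<^sup>2" for k
  proof -
    have "0 < t ^ (r * (m + k)) * (gfib s (- t) r)\<^sup>2"
      using t_ge1 gfib_pos[OF r] by simp
    then show ?thesis using Catalan[of k] by linarith
  qed
  moreover have "3 * q k \<le> q (Suc k)" for k
    using gfib_add_ge_3[OF s_ge4 r] unfolding q_Suc by (simp add: q_def)
  moreover have "0 \<le> q 0" "0 < q (Suc 0)"
    using gfib_nonneg gfib_pos r by (simp_all add: q_def)
  ultimately show "summable (\<lambda>k. 1 / real_of_int (gfib s (- t) (r * (Suc m + k))))"
    and "\<lfloor>inverse (\<Sum>k. 1 / real_of_int (gfib s (- t) (r * (Suc m + k))))\<rfloor>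
      = gfib s (- t) (r * Suc m) - gfib s (- t) (r * m) - 1"
    using floor_inverse_reciprocal_sum[of q] unfolding q_def by simp_all
qed

end

lemma gfib_reciprocal_square_sum:
  fixes s :: int
  assumes s_ge4: "4 \<le> s" and r: "0 < r"
  shows "summable (\<lambda>k. 1 / (real_of_int (gfib s (-1) (r * (Suc m + k))))\<^sup>2)"
    and "\<lfloor>inverse (\<Sum>k. 1 / (real_of_int (gfib s (-1) (r * (Suc m + k))))\<^sup>2)\<rfloor>
      = (gfib s (-1) (r * Suc m))\<^sup>2 - (gfib s (-1) (r * m))\<^sup>2 - 1"
proof -
  have s_gt: "1 < s" using s_ge4 by simp
  define g where "g k = gfib s (-1) (r * (m + k))" for k
  define q where "q k = (g k)\<^sup>2" for k
  \<comment> \<open>For t = 1 the Catalan defect of g is this constant. Squaring the identity then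
    gives the defect of q.\<close>
  define c where "c = (gfib s (-1) r)\<^sup>2"
  have g_Suc: "g (Suc k) = gfib s (-1) (r * (m + k) + r)"
    and g_Suc2: "g (Suc (Suc k)) = gfib s (-1) (r * (m + k) + r + r)" for k
    unfolding g_def by (simp_all add: algebra_simps)
  have Catalan: "g k * g (Suc (Suc k)) = q (Suc k) - c" for k
    using gfib_Catalan[of s "-1" "r * (m + k)" r] unfolding q_def c_def g_Suc2 unfolding g_Suc
    by (simp add: g_def)
  have product: "(q (Suc k))\<^sup>2 - q k * q (Suc (Suc k)) = c * (2 * q (Suc k) - c)" for k
  proof -
    have "q k * q (Suc (Suc k)) = (q (Suc k) - c)\<^sup>2"
      unfolding Catalan[symmetric] by (simp add: q_def power_mult_distrib)
    then show ?thesis by (simp add: algebra_simps power2_eq_square)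
  qed
  have g_nonneg: "0 \<le> g k" for k
    using gfib_nonneg[OF _ s_gt] by (simp add: g_def)
  have c_pos: "1 \<le> c"
    using gfib_pos[OF _ s_gt r] unfolding c_def by (simp add: int_one_le_iff_zero_less)
  have c_le: "c \<le> q (Suc k)" for k
    using gfib_mono[OF _ s_gt, of r "r * (m + k) + r"] gfib_nonneg[OF _ s_gt, of r]
    unfolding c_def q_def g_Suc by (intro power_mono) auto
  have growth: "3 * q k \<le> q (Suc k)" for k
  proof -
    have "(3 * g k)\<^sup>2 \<le> q (Suc k)"
      using gfib_add_ge_3[OF _ s_gt s_ge4 r, of "r * (m + k)"] g_nonneg[of k]
      unfolding q_def g_Suc by (intro power_mono) (auto simp: g_def)
    moreover have "3 * q k \<le> (3 * g k)\<^sup>2"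
      by (simp add: q_def power_mult_distrib)
    ultimately show ?thesis by linarith
  qed
  have "(q (Suc k))\<^sup>2 - q k * q (Suc (Suc k)) \<le> q (Suc (Suc k)) - q k - 1" for k
  proof -
    \<comment> \<open>Squaring turns the factor 2 into 4, so q (k + 2) >= 4 * c * q (k + 1), against
      a defect of at most 2 * c * q (k + 1); the surplus covers q k + 1.\<close>
    have "(2 * (g (Suc k) * gfib s (-1) r))\<^sup>2 \<le> q (Suc (Suc k))"
      using gfib_add_ge_twice[OF _ s_gt s_ge4, of "r * (m + k) + r" r] g_nonneg[of "Suc k"]
        gfib_nonneg[OF _ s_gt, of r]
      unfolding q_def g_Suc2 unfolding g_Suc by (intro power_mono) auto
    then have "4 * (c * q (Suc k)) \<le> q (Suc (Suc k))"
      by (simp add: q_def c_def power_mult_distrib mult_ac)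
    moreover have "1 * q (Suc k) \<le> c * q (Suc k)"
      using c_pos by (intro mult_right_mono) (auto simp: q_def)
    moreover have "q k + 1 \<le> q (Suc k)"
      using growth[of k] c_pos c_le[of k] by (simp add: q_def)
    moreover have "0 \<le> c * c" "0 \<le> q k" by (simp_all add: q_def)
    moreover have "c * (2 * q (Suc k) - c) = 2 * (c * q (Suc k)) - c * c"
      by (simp add: algebra_simps)
    ultimately show ?thesis
      unfolding product by linarith
  qed
  moreover have "q k * q (Suc (Suc k)) < (q (Suc k))\<^sup>2" for k
  proof -
    \<comment> \<open>From c <= q (k + 1) the second factor is at least c.\<close>
    have "0 < c * (2 * q (Suc k) - c)"
      using c_pos c_le[of k] by (intro mult_pos_pos) auto
    then show ?thesis using product[of k] by linarith
  qed
  moreover have "0 \<le> q 0" "0 < q (Suc 0)"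
    using c_le[of 0] c_pos by (auto simp: q_def)
  ultimately show "summable (\<lambda>k. 1 / (real_of_int (gfib s (-1) (r * (Suc m + k))))\<^sup>2)"
    and "\<lfloor>inverse (\<Sum>k. 1 / (real_of_int (gfib s (-1) (r * (Suc m + k))))\<^sup>2)\<rfloor>
      = (gfib s (-1) (r * Suc m))\<^sup>2 - (gfib s (-1) (r * m))\<^sup>2 - 1"
    using floor_inverse_reciprocal_sum[of q] growth unfolding q_def g_def by simp_all
qed

theorem theorem18:
  fixes n r :: nat
  assumes "n > 0" and "r > 0"
  shows "(\<exists>N::int. \<forall>s t::int. s > t \<and> t \<ge> N \<longrightarrow>
            t \<ge> 1 \<and> (s, -t) \<noteq> (2, -1) \<and>
            summable (\<lambda>k. 1 / real_of_int (gfib s (-t) (r * (n + k)))) \<and>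
            \<lfloor>inverse (\<Sum>k. 1 / real_of_int (gfib s (-t) (r * (n + k))))\<rfloor>
              = gfib s (-t) (r * n) - gfib s (-t) (r * (n - 1)) - 1)
       \<and> (\<exists>S::int. \<forall>s::int. s \<ge> S \<longrightarrow>
            summable (\<lambda>k. 1 / (real_of_int (gfib s (-1) (r * (n + k))))\<^sup>2) \<and>
            \<lfloor>inverse (\<Sum>k. 1 / (real_of_int (gfib s (-1) (r * (n + k))))\<^sup>2)\<rfloor>
              = (gfib s (-1) (r * n))\<^sup>2 - (gfib s (-1) (r * (n - 1)))\<^sup>2 - 1)"
proof -
  obtain m where n: "n = Suc m"
    using assms(1) gr0_implies_Suc by blast
  show ?thesis
  proof (rule conjI; rule exI[of _ "4::int"]; intro allI impI conjI)
    fix s t :: int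
    assume "s > t \<and> t \<ge> 4"
    then have st: "1 \<le> t" "t < s" "4 \<le> s" by auto
    show "t \<ge> 1" "(s, -t) \<noteq> (2, -1)" using st by auto
    show "summable (\<lambda>k. 1 / real_of_int (gfib s (-t) (r * (n + k))))"
      unfolding n using st assms(2) by (rule gfib_reciprocal_sum)
    show "\<lfloor>inverse (\<Sum>k. 1 / real_of_int (gfib s (-t) (r * (n + k))))\<rfloor>
        = gfib s (-t) (r * n) - gfib s (-t) (r * (n - 1)) - 1"
      unfolding n diff_Suc_1 using st assms(2) by (rule gfib_reciprocal_sum)
  next
    fix s :: int
    assume s: "s \<ge> 4"
    show "summable (\<lambda>k. 1 / (real_of_int (gfib s (-1) (r * (n + k))))\<^sup>2)"
      unfolding n using s assms(2) by (rule gfib_reciprocal_square_sum)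
    show "\<lfloor>inverse (\<Sum>k. 1 / (real_of_int (gfib s (-1) (r * (n + k))))\<^sup>2)\<rfloor>
        = (gfib s (-1) (r * n))\<^sup>2 - (gfib s (-1) (r * (n - 1)))\<^sup>2 - 1"
      unfolding n diff_Suc_1 using s assms(2) by (rule gfib_reciprocal_square_sum)
  qed
qed

end
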